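(* Let $\mathcal{R}$ be a principal ideal domain, $n\in\mathcal{R}$, $n\neq 0$, and let $(\mathcal{R}/n\mathcal{R})[x]$ be the polynomial ring in $x=(x_1,\dots,x_N)$ with a fixed global monomial order $<$. Let $I\subseteq(\mathcal{R}/n\mathcal{R})[x]$ be an ideal and $n=a\cdot b$ a factorization of $n$ into coprime elements $a,b\in\mathcal{R}$; let $u,v\in\mathcal{R}$ with $1=ua+vb$. Let $\mathcal{K},\mathcal{L}$ be finite index sets. Assume that $G_a=(g_{a,k})_{k\in\mathcal{K}}\subseteq(\mathcal{R}/n\mathcal{R})[x]$ is a set of polynomials such that $\pi_a(G_a)\subseteq(\mathcal{R}/a\mathcal{R})[x]$ is a strong Gr\"obner basis of $\pi_a(I)\subseteq(\mathcal{R}/a\mathcal{R})[x]$, $a\in G_a$, and for every $g\in G_a\setminus\{a\}$ the leading coefficient $\mathrm{lc}(g)$ divides $a$ and is not divisible by $a$. Assume that $G_b=(g_{b,l})_{l\in\mathcal{L}}\subseteq(\mathcal{R}/n\mathcal{R})[x]$ has the same properties with respect to $b$, i.e. $\pi_b(G_b)$ is a strong Gr\"obner basis of $\pi_b(I)\subseteq(\mathcal{R}/b\mathcal{R})[x]$, $b\in G_b$, and for every $g\in G_b\setminus\{b\}$ the leading coefficient $\mathrm{lc}(g)$ divides $b$ and is not divisible by $b$. For $k\in\mathcal{K}$, $l\in\mathcal{L}$ define $$f_{k,l}=ua\,\frac{\mathrm{lcm}(\mathrm{lm}(g_{a,k}),\mathrm{lm}(g_{b,l}))}{\mathrm{lm}(g_{b,l})}\cdot\mathrm{lc}(g_{a,k})\,g_{b,l}+vb\,\frac{\mathrm{lcm}(\mathrm{lm}(g_{a,k}),\mathrm{lm}(g_{b,l}))}{\mathrm{lm}(g_{a,k})}\cdot\mathrm{lc}(g_{b,l})\,g_{a,k}\in(\mathcal{R}/n\mathcal{R})[x].$$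 Then $G=\{f_{k,l}\mid k\in\mathcal{K},\,l\in\mathcal{L}\}$ is a strong Gr\"obner basis of $I$.
   Context: Elements $a,b,u,v\in\mathcal{R}$ are identified with their images in $\mathcal{R}/n\mathcal{R}$ whenever they are used there; divisibility of lead coefficients by or into $a$, $b$ is in $\mathcal{R}/n\mathcal{R}$. For a divisor $a$ of $n$, $\pi_a\colon(\mathcal{R}/n\mathcal{R})[x]\to(\mathcal{R}/a\mathcal{R})[x]$ is the coefficientwise canonical projection. A monomial order is global if $x^\alpha\ge 1$ for all exponents $\alpha$; the same order is used over all coefficient rings. For a nonzero polynomial $f$, $\mathrm{lm}(f)$ is its largest monomial with respect to $<$, $\mathrm{lc}(f)$ the coefficient of that monomial (lead coefficient), and $\mathrm{lt}(f)=\mathrm{lc}(f)\,\mathrm{lm}(f)$ (lead term). In particular, the elements of $G_a\setminus\{a\}$ and $G_b\setminus\{b\}$ are nonzero. For a set $F$ of polynomials, $L(F)$ is the ideal generated by the $\mathrm{lt}(f)$ with $0\neq f\in F$. Let $S$ be a unital commutative ring in which every ideal is principal. A finite subset $G\subset S[x]$ is a Gr\"obner basis of an ideal $J\subseteq S[x]$ if $G\subset J$ and $L(G)=L(J)$; it is a strong Gr\"obner basis of $J$ if moreover for every $f\in J\setminus\{0\}$ there is a nonzero $g\in G$ with $\mathrm{lt}(g)\mid\mathrm{lt}(f)$. Zero elements in such a set are permitted and play no role. If $g_{a,k}=0$ or $g_{b,l}=0$ (so that lead data are undefined), put $f_{k,l}=0$. *)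

theory Defs
  imports "HOL-Algebra.Ring_Divisibility" "HOL-Algebra.QuotRing" "HOL-Library.Multiset"
begin

text \<open>
  The monomial \<open>x\<^sup>\<alpha>\<close> is the multiset \<open>\<alpha>\<close> of the
  variables occurring in it, and a polynomial is its coefficient function. So \<open>\<alpha> + \<beta>\<close> is the
  product of monomials, \<open>{#}\<close> is \<open>1\<close>, \<open>\<subseteq>#\<close> is divisibility, \<open>\<union>#\<close> is the least common multiple, and
  \<open>\<alpha> - \<beta>\<close> is the quotient when \<open>\<beta> \<subseteq># \<alpha>\<close>. The variables are the elements of \<open>'x\<close>, which is taken
  finite in the theorem.
\<close>

definition mpoly :: "('a, 'm) ring_scheme \<Rightarrow> ('x multiset \<Rightarrow> 'a) ring" where
  "mpoly S =
    \<lparr> carrier = {p. (\<forall>\<alpha>. p \<alpha> \<in> carrier S) \<and> finite {\<alpha>. p \<alpha> \<noteq> \<zero>\<^bsub>S\<^esub>}},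
      mult = (\<lambda>p q \<alpha>. \<Oplus>\<^bsub>S\<^esub>\<beta>\<in>{\<beta>. \<beta> \<subseteq># \<alpha>}. p \<beta> \<otimes>\<^bsub>S\<^esub> q (\<alpha> - \<beta>)),
      one = (\<lambda>\<alpha>. if \<alpha> = {#} then \<one>\<^bsub>S\<^esub> else \<zero>\<^bsub>S\<^esub>),
      zero = (\<lambda>\<alpha>. \<zero>\<^bsub>S\<^esub>),
      add = (\<lambda>p q \<alpha>. p \<alpha> \<oplus>\<^bsub>S\<^esub> q \<alpha>) \<rparr>"

definition mterm :: "('a, 'm) ring_scheme \<Rightarrow> 'a \<Rightarrow> 'x multiset \<Rightarrow> ('x multiset \<Rightarrow> 'a)" where
  "mterm S c \<alpha> = (\<lambda>\<beta>. if \<beta> = \<alpha> then c else \<zero>\<^bsub>S\<^esub>)"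

abbreviation mconst :: "('a, 'm) ring_scheme \<Rightarrow> 'a \<Rightarrow> ('x multiset \<Rightarrow> 'a)" where
  "mconst S c \<equiv> mterm S c {#}"

definition monomial_order :: "('x multiset \<Rightarrow> 'x multiset \<Rightarrow> bool) \<Rightarrow> bool" where
  "monomial_order leq \<longleftrightarrow>
     class.linorder leq (\<lambda>\<alpha> \<beta>. leq \<alpha> \<beta> \<and> \<not> leq \<beta> \<alpha>) \<and>
     (\<forall>\<alpha> \<beta> \<gamma>. leq \<alpha> \<beta> \<longrightarrow> leq (\<alpha> + \<gamma>) (\<beta> + \<gamma>))"

definition global_monomial_order :: "('x multiset \<Rightarrow> 'x multiset \<Rightarrow> bool) \<Rightarrow> bool" where
  "global_monomial_order leq \<longleftrightarrow> monomial_order leq \<and> (\<forall>\<alpha>. leq {#} \<alpha>)"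

text \<open>The lead data are meaningful only for nonzero polynomials; every use below is guarded.\<close>

definition lm :: "('x multiset \<Rightarrow> 'x multiset \<Rightarrow> bool) \<Rightarrow> ('a, 'm) ring_scheme
    \<Rightarrow> ('x multiset \<Rightarrow> 'a) \<Rightarrow> 'x multiset" where
  "lm leq S f = (THE \<alpha>. f \<alpha> \<noteq> \<zero>\<^bsub>S\<^esub> \<and> (\<forall>\<beta>. f \<beta> \<noteq> \<zero>\<^bsub>S\<^esub> \<longrightarrow> leq \<beta> \<alpha>))"

definition lc :: "('x multiset \<Rightarrow> 'x multiset \<Rightarrow> bool) \<Rightarrow> ('a, 'm) ring_scheme
    \<Rightarrow> ('x multiset \<Rightarrow> 'a) \<Rightarrow> 'a" where
  "lc leq S f = f (lm leq S f)"

definition lt :: "('x multiset \<Rightarrow> 'x multiset \<Rightarrow> bool) \<Rightarrow> ('a, 'm) ring_scheme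
    \<Rightarrow> ('x multiset \<Rightarrow> 'a) \<Rightarrow> ('x multiset \<Rightarrow> 'a)" where
  "lt leq S f = mterm S (lc leq S f) (lm leq S f)"

definition lead_ideal :: "('x multiset \<Rightarrow> 'x multiset \<Rightarrow> bool) \<Rightarrow> ('a, 'm) ring_scheme
    \<Rightarrow> ('x multiset \<Rightarrow> 'a) set \<Rightarrow> ('x multiset \<Rightarrow> 'a) set" where
  "lead_ideal leq S F = Idl\<^bsub>mpoly S\<^esub> (lt leq S ` {f \<in> F. f \<noteq> \<zero>\<^bsub>mpoly S\<^esub>})"

text \<open>In the next two definitions \<open>J\<close> is meant to be an ideal of \<open>mpoly S\<close>.\<close>

definition groebner_basis :: "('x multiset \<Rightarrow> 'x multiset \<Rightarrow> bool) \<Rightarrow> ('a, 'm) ring_scheme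
    \<Rightarrow> ('x multiset \<Rightarrow> 'a) set \<Rightarrow> ('x multiset \<Rightarrow> 'a) set \<Rightarrow> bool" where
  "groebner_basis leq S J G \<longleftrightarrow>
     finite G \<and> G \<subseteq> J \<and> lead_ideal leq S G = lead_ideal leq S J"

definition strong_groebner_basis :: "('x multiset \<Rightarrow> 'x multiset \<Rightarrow> bool) \<Rightarrow> ('a, 'm) ring_scheme
    \<Rightarrow> ('x multiset \<Rightarrow> 'a) set \<Rightarrow> ('x multiset \<Rightarrow> 'a) set \<Rightarrow> bool" where
  "strong_groebner_basis leq S J G \<longleftrightarrow>
     groebner_basis leq S J G \<and>
     (\<forall>f \<in> J - {\<zero>\<^bsub>mpoly S\<^esub>}. \<exists>g \<in> G - {\<zero>\<^bsub>mpoly S\<^esub>}. lt leq S g divides\<^bsub>mpoly S\<^esub> lt leq S f)"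

abbreviation residue_ring :: "('r, 'm) ring_scheme \<Rightarrow> 'r \<Rightarrow> 'r set ring" where
  "residue_ring R n \<equiv> R Quot (PIdl\<^bsub>R\<^esub> n)"

abbreviation residue :: "('r, 'm) ring_scheme \<Rightarrow> 'r \<Rightarrow> 'r \<Rightarrow> 'r set" where
  "residue R n r \<equiv> (PIdl\<^bsub>R\<^esub> n) +>\<^bsub>R\<^esub> r"

text \<open>
  If \<open>a\<close> divides \<open>n\<close>, then \<open>aR + (r + nR) = r + aR\<close>; so adding the set \<open>aR\<close> to a coset is the
  canonical projection \<open>R/nR \<rightarrow> R/aR\<close>.
\<close>

definition proj_poly :: "('r, 'm) ring_scheme \<Rightarrow> 'r \<Rightarrow> ('x multiset \<Rightarrow> 'r set)
    \<Rightarrow> ('x multiset \<Rightarrow> 'r set)" where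
  "proj_poly R a p = (\<lambda>\<alpha>. (PIdl\<^bsub>R\<^esub> a) <+>\<^bsub>R\<^esub> p \<alpha>)"

definition glue_poly :: "('x multiset \<Rightarrow> 'x multiset \<Rightarrow> bool) \<Rightarrow> ('r, 'm) ring_scheme
    \<Rightarrow> 'r \<Rightarrow> 'r \<Rightarrow> 'r \<Rightarrow> 'r \<Rightarrow> 'r
    \<Rightarrow> ('x multiset \<Rightarrow> 'r set) \<Rightarrow> ('x multiset \<Rightarrow> 'r set) \<Rightarrow> ('x multiset \<Rightarrow> 'r set)" where
  "glue_poly leq R n u a v b g h =
    (let Q = residue_ring R n; P = mpoly Q; m = lm leq Q g \<union># lm leq Q h in
     if g = \<zero>\<^bsub>P\<^esub> \<or> h = \<zero>\<^bsub>P\<^esub> then \<zero>\<^bsub>P\<^esub>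
     else
       mterm Q (residue R n (u \<otimes>\<^bsub>R\<^esub> a) \<otimes>\<^bsub>Q\<^esub> lc leq Q g) (m - lm leq Q h) \<otimes>\<^bsub>P\<^esub> h
       \<oplus>\<^bsub>P\<^esub> mterm Q (residue R n (v \<otimes>\<^bsub>R\<^esub> b) \<otimes>\<^bsub>Q\<^esub> lc leq Q h) (m - lm leq Q g) \<otimes>\<^bsub>P\<^esub> g)"

end

theory Submission
  imports Defs
begin

text \<open>
  Let \<open>c x\<^sup>\<alpha>\<close> be the lead term of a nonzero \<open>f \<in> I\<close>. The strong Groebner basis modulo \<open>a\<close> (or
  the constant \<open>a\<close> itself, when \<open>a\<close> divides \<open>c\<close>) supplies a \<open>g\<close> with \<open>lm(g)\<close> dividing
  \<open>x\<^sup>\<alpha>\<close> and \<open>lc(g)\<close> dividing both \<open>c\<close> and \<open>a\<close>; likewise there is an \<open>h\<close> for \<open>b\<close>. Writing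
  \<open>c = ua c + vb c\<close> one sees that \<open>lc(g) lc(h)\<close> divides \<open>c\<close>, so it is nonzero, and
  \<open>ua + vb = 1\<close> makes it the lead coefficient of the glued polynomial, at the monomial
  \<open>lcm(lm(g), lm(h))\<close>. The glued polynomials lie in \<open>I\<close> because \<open>g\<close> agrees modulo \<open>a\<close>
  with an element of \<open>I\<close> and \<open>vb\<close> annihilates the multiples of \<open>a\<close>.
\<close>

section \<open>Products with terms and divisibility of terms\<close>

text \<open>A \<open>finsum\<close> over an infinite set is zero by default, so the convolution in
  \<open>mpoly\<close> can be evaluated only once its index set is known to be finite.\<close>

lemma finite_submultisets: "finite {\<beta>. \<beta> \<subseteq># \<alpha>}"
proof (induction \<alpha>)
  case empty
  then show ?case by simp
next
  case (add x \<alpha>)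
  have "{\<beta>. \<beta> \<subseteq># add_mset x \<alpha>} \<subseteq> {\<beta>. \<beta> \<subseteq># \<alpha>} \<union> add_mset x ` {\<beta>. \<beta> \<subseteq># \<alpha>}"
  proof
    fix \<beta> assume "\<beta> \<in> {\<beta>. \<beta> \<subseteq># add_mset x \<alpha>}"
    then have sub: "\<beta> \<subseteq># add_mset x \<alpha>" by simp
    show "\<beta> \<in> {\<beta>. \<beta> \<subseteq># \<alpha>} \<union> add_mset x ` {\<beta>. \<beta> \<subseteq># \<alpha>}"
    proof (cases "x \<in># \<beta>")
      case True
      then obtain \<gamma> where "\<beta> = add_mset x \<gamma>" by (meson mset_add)
      with sub show ?thesis by auto
    next
      case False
      with sub show ?thesis
        by (metis UnI1 add_mset_add_single diff_single_trivial mem_Collect_eq subset_eq_diff_conv)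
    qed
  qed
  with add show ?case by (meson finite_UnI finite_imageI finite_subset)
qed

lemma mpoly_carrier_coeff: "p \<in> carrier (mpoly S) \<Longrightarrow> p \<alpha> \<in> carrier S"
  by (simp add: mpoly_def)

lemma mpoly_zero: "\<zero>\<^bsub>mpoly S\<^esub> = (\<lambda>\<alpha>. \<zero>\<^bsub>S\<^esub>)"
  by (simp add: mpoly_def)

lemma mpoly_add_coeff: "(p \<oplus>\<^bsub>mpoly S\<^esub> q) \<alpha> = p \<alpha> \<oplus>\<^bsub>S\<^esub> q \<alpha>"
  by (simp add: mpoly_def)

lemma (in ring) mterm_closed: "c \<in> carrier R \<Longrightarrow> mterm R c \<gamma> \<in> carrier (mpoly R)"
  by (auto simp: mpoly_def mterm_def intro: finite_subset[of _ "{\<gamma>}"])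

text \<open>Only the summand at \<open>\<gamma>\<close> of the convolution survives. Every product
  below has a term as its left factor, so this formula is all that is ever computed from the
  convolution.\<close>

lemma (in ring) mterm_mult_coeff:
  assumes c: "c \<in> carrier R" and p: "\<And>\<beta>. p \<beta> \<in> carrier R"
  shows "(mterm R c \<gamma> \<otimes>\<^bsub>mpoly R\<^esub> p) \<alpha> = (if \<gamma> \<subseteq># \<alpha> then c \<otimes> p (\<alpha> - \<gamma>) else \<zero>)"
proof -
  have eq: "(mterm R c \<gamma> \<otimes>\<^bsub>mpoly R\<^esub> p) \<alpha> =
      (\<Oplus>\<beta>\<in>{\<beta>. \<beta> \<subseteq># \<alpha>}. if \<gamma> = \<beta> then c \<otimes> p (\<alpha> - \<beta>) else \<zero>)"
    unfolding mpoly_def mterm_def using c p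
    by (auto intro!: finsum_cong' simp: Pi_def)
  show ?thesis
  proof (cases "\<gamma> \<subseteq># \<alpha>")
    case True
    then show ?thesis
      unfolding eq using finsum_singleton[of \<gamma> "{\<beta>. \<beta> \<subseteq># \<alpha>}" "\<lambda>\<beta>. c \<otimes> p (\<alpha> - \<beta>)"] c p
      by (simp add: finite_submultisets Pi_def)
  next
    case False
    then have "(\<Oplus>\<beta>\<in>{\<beta>. \<beta> \<subseteq># \<alpha>}. if \<gamma> = \<beta> then c \<otimes> p (\<alpha> - \<beta>) else \<zero>)
        = (\<Oplus>\<beta>\<in>{\<beta>. \<beta> \<subseteq># \<alpha>}. \<zero>)"
      by (intro finsum_cong') auto
    with False show ?thesis unfolding eq by simp
  qed
qed

lemma (in ring) mterm_mult_mterm: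
  assumes "c \<in> carrier R" "d \<in> carrier R"
  shows "mterm R c \<gamma> \<otimes>\<^bsub>mpoly R\<^esub> mterm R d \<delta> = mterm R (c \<otimes> d) (\<gamma> + \<delta>)"
proof
  fix \<alpha>
  have "(mterm R c \<gamma> \<otimes>\<^bsub>mpoly R\<^esub> mterm R d \<delta>) \<alpha>
      = (if \<gamma> \<subseteq># \<alpha> then c \<otimes> mterm R d \<delta> (\<alpha> - \<gamma>) else \<zero>)"
    by (rule mterm_mult_coeff) (use assms in \<open>auto simp: mterm_def\<close>)
  then show "(mterm R c \<gamma> \<otimes>\<^bsub>mpoly R\<^esub> mterm R d \<delta>) \<alpha> = mterm R (c \<otimes> d) (\<gamma> + \<delta>) \<alpha>"
    using assms by (auto simp: mterm_def subset_mset.add_diff_inverse)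
qed

lemma (in ring) mterm_dividesI:
  assumes "c \<in> carrier R" and "\<gamma> \<subseteq># \<delta>" and "c divides d"
  shows "mterm R c \<gamma> divides\<^bsub>mpoly R\<^esub> mterm R d \<delta>"
proof -
  from assms(3) obtain t where t: "t \<in> carrier R" "d = c \<otimes> t" by (auto simp: factor_def)
  have "mterm R d \<delta> = mterm R c \<gamma> \<otimes>\<^bsub>mpoly R\<^esub> mterm R t (\<delta> - \<gamma>)"
    using assms t by (simp add: mterm_mult_mterm)
  with t show ?thesis by (auto simp: factor_def intro: mterm_closed)
qed

text \<open>The coefficient at \<open>\<delta>\<close> of a multiple of the first term is either a
  multiple of \<open>c\<close> or the default zero, and \<open>d\<close> nonzero excludes the
  latter. Zero divisors in \<open>R\<close> do no harm.\<close>

lemma (in ring) mterm_dividesD: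
  assumes "c \<in> carrier R" and "d \<noteq> \<zero>" and "mterm R c \<gamma> divides\<^bsub>mpoly R\<^esub> mterm R d \<delta>"
  shows "\<gamma> \<subseteq># \<delta>" and "c divides d"
proof -
  from assms(3) obtain q where q: "q \<in> carrier (mpoly R)"
    and eq: "mterm R d \<delta> = mterm R c \<gamma> \<otimes>\<^bsub>mpoly R\<^esub> q" by (auto simp: factor_def)
  have "d = (mterm R c \<gamma> \<otimes>\<^bsub>mpoly R\<^esub> q) \<delta>"
    using eq by (metis mterm_def)
  also have "\<dots> = (if \<gamma> \<subseteq># \<delta> then c \<otimes> q (\<delta> - \<gamma>) else \<zero>)"
    by (rule mterm_mult_coeff) (use assms q in \<open>auto intro: mpoly_carrier_coeff\<close>)
  finally have *: "d = (if \<gamma> \<subseteq># \<delta> then c \<otimes> q (\<delta> - \<gamma>) else \<zero>)" .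
  with assms(2) show "\<gamma> \<subseteq># \<delta>" by (auto split: if_splits)
  with * q show "c divides d" by (auto simp: factor_def intro: mpoly_carrier_coeff)
qed

section \<open>Lead monomials\<close>

lemma monomial_order_linorder:
  "monomial_order leq \<Longrightarrow> class.linorder leq (\<lambda>\<alpha> \<beta>. leq \<alpha> \<beta> \<and> \<not> leq \<beta> \<alpha>)"
  by (simp add: monomial_order_def)

lemma monomial_order_add: "monomial_order leq \<Longrightarrow> leq \<alpha> \<beta> \<Longrightarrow> leq (\<alpha> + \<gamma>) (\<beta> + \<gamma>)"
  by (simp add: monomial_order_def)

text \<open>Antisymmetry gives uniqueness of the largest monomial. The description operator in
  \<open>lm\<close> is unfolded only here.\<close>

lemma lm_eqI:
  assumes "monomial_order leq" and "f \<alpha> \<noteq> \<zero>\<^bsub>S\<^esub>" and "\<And>\<beta>. f \<beta> \<noteq> \<zero>\<^bsub>S\<^esub> \<Longrightarrow> leq \<beta> \<alpha>"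
  shows "lm leq S f = \<alpha>"
proof -
  interpret O: linorder leq "\<lambda>\<alpha> \<beta>. leq \<alpha> \<beta> \<and> \<not> leq \<beta> \<alpha>"
    using assms(1) by (rule monomial_order_linorder)
  show ?thesis
    unfolding lm_def by (rule the_equality) (use assms O.order.antisym in blast)+
qed

text \<open>The support is finite and nonempty, so a total order has a largest element on
  it.\<close>

lemma lm_greatest:
  assumes mo: "monomial_order leq" and f: "f \<in> carrier (mpoly S)" "f \<noteq> \<zero>\<^bsub>mpoly S\<^esub>"
  shows "f (lm leq S f) \<noteq> \<zero>\<^bsub>S\<^esub>" and "\<And>\<beta>. f \<beta> \<noteq> \<zero>\<^bsub>S\<^esub> \<Longrightarrow> leq \<beta> (lm leq S f)"
proof -
  interpret O: linorder leq "\<lambda>\<alpha> \<beta>. leq \<alpha> \<beta> \<and> \<not> leq \<beta> \<alpha>"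
    using mo by (rule monomial_order_linorder)
  let ?A = "{\<alpha>. f \<alpha> \<noteq> \<zero>\<^bsub>S\<^esub>}"
  have "finite ?A" and "?A \<noteq> {}"
    using f by (auto simp: mpoly_def)
  then have "\<exists>\<alpha>\<in>?A. \<forall>\<beta>\<in>?A. leq \<beta> \<alpha>"
    by (induction rule: finite_ne_induct) (auto, metis O.linear O.order.trans)
  then obtain \<alpha> where *: "f \<alpha> \<noteq> \<zero>\<^bsub>S\<^esub>" "\<And>\<beta>. f \<beta> \<noteq> \<zero>\<^bsub>S\<^esub> \<Longrightarrow> leq \<beta> \<alpha>" by blast
  have "lm leq S f = \<alpha>" using mo * by (rule lm_eqI)
  with * show "f (lm leq S f) \<noteq> \<zero>\<^bsub>S\<^esub>" and "\<And>\<beta>. f \<beta> \<noteq> \<zero>\<^bsub>S\<^esub> \<Longrightarrow> leq \<beta> (lm leq S f)" by auto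
qed

lemma lm_mconst:
  assumes mo: "monomial_order leq" and "c \<noteq> \<zero>\<^bsub>S\<^esub>"
  shows "lm leq S (mconst S c) = {#}"
proof -
  interpret O: linorder leq "\<lambda>\<alpha> \<beta>. leq \<alpha> \<beta> \<and> \<not> leq \<beta> \<alpha>"
    using mo by (rule monomial_order_linorder)
  show ?thesis
    by (rule lm_eqI[OF mo]) (use assms(2) in \<open>auto simp: mterm_def split: if_splits\<close>)
qed

section \<open>A divisibility criterion for strong Groebner bases\<close>

text \<open>Divisibility already forces equality of the lead ideals: each lead term from
  \<open>J\<close> is a multiple of one from \<open>G\<close> and so lies in every ideal that
  contains the lead terms from \<open>G\<close>.\<close>

lemma strong_groebner_basisI:
  assumes "finite G" and GJ: "G \<subseteq> J"
    and div: "\<And>f. f \<in> J \<Longrightarrow> f \<noteq> \<zero>\<^bsub>mpoly S\<^esub> \<Longrightarrow>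
      \<exists>g\<in>G. g \<noteq> \<zero>\<^bsub>mpoly S\<^esub> \<and> lt leq S g divides\<^bsub>mpoly S\<^esub> lt leq S f"
  shows "strong_groebner_basis leq S J G"
proof -
  let ?LG = "lt leq S ` {f \<in> G. f \<noteq> \<zero>\<^bsub>mpoly S\<^esub>}"
  let ?LJ = "lt leq S ` {f \<in> J. f \<noteq> \<zero>\<^bsub>mpoly S\<^esub>}"
  \<comment> \<open>A generated ideal is the intersection of all ideals containing the generators,
    so it suffices that both sets of lead terms lie in the same ideals.\<close>
  have "?LG \<subseteq> M \<longleftrightarrow> ?LJ \<subseteq> M" if M: "ideal M (mpoly S)" for M
  proof
    assume LG: "?LG \<subseteq> M"
    show "?LJ \<subseteq> M"
    proof
      fix t assume "t \<in> ?LJ"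
      then obtain f where f: "f \<in> J" "f \<noteq> \<zero>\<^bsub>mpoly S\<^esub>" "t = lt leq S f" by blast
      then obtain g q where "g \<in> G" "g \<noteq> \<zero>\<^bsub>mpoly S\<^esub>" "q \<in> carrier (mpoly S)"
        and "lt leq S f = lt leq S g \<otimes>\<^bsub>mpoly S\<^esub> q"
        using div[OF f(1,2)] unfolding factor_def by blast
      with LG f(3) show "t \<in> M" by (auto intro!: ideal.I_r_closed[OF M])
    qed
  qed (use GJ in blast)
  then have "lead_ideal leq S G = lead_ideal leq S J"
    unfolding lead_ideal_def genideal_def by (intro arg_cong[where f = "\<Inter>"]) blast
  moreover have "\<forall>f \<in> J - {\<zero>\<^bsub>mpoly S\<^esub>}. \<exists>g \<in> G - {\<zero>\<^bsub>mpoly S\<^esub>}. lt leq S g divides\<^bsub>mpoly S\<^esub> lt leq S f"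
    using div by blast
  ultimately show ?thesis
    using assms(1,2) by (simp add: strong_groebner_basis_def groebner_basis_def)
qed

section \<open>Lifting from a quotient\<close>

text \<open>Elements with the same image differ by a multiple of \<open>a\<close>, which
  \<open>b\<close> kills.\<close>

lemma (in cring) factor_annihilates:
  assumes ker: "\<And>x. x \<in> carrier R \<Longrightarrow> \<phi> x = \<zero>\<^bsub>A\<^esub> \<Longrightarrow> a divides x"
    and \<phi>: "ring_hom_ring R A \<phi>"
    and "a \<in> carrier R" "b \<in> carrier R" "b \<otimes> a = \<zero>"
    and x: "x \<in> carrier R" and y: "y \<in> carrier R" and eq: "\<phi> x = \<phi> y"
  shows "b \<otimes> x = b \<otimes> y"
proof -
  interpret \<phi>: ring_hom_ring R A \<phi> by (rule \<phi>)
  have "\<phi> (x \<ominus> y) = \<zero>\<^bsub>A\<^esub>"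
    using x y eq by (simp add: a_minus_def \<phi>.S.r_neg)
  then obtain t where t: "t \<in> carrier R" "x \<ominus> y = a \<otimes> t"
    using ker[of "x \<ominus> y"] x y by (auto simp: factor_def)
  have "b \<otimes> (x \<ominus> y) = \<zero>"
    using assms t by (metis l_null m_assoc)
  moreover have "b \<otimes> (x \<ominus> y) = b \<otimes> x \<ominus> b \<otimes> y"
    using assms by algebra
  ultimately show ?thesis using assms by simp
qed

text \<open>The basis of the image gives divisibility of lead coefficients only modulo
  \<open>a\<close>. Since \<open>lc leq R g\<close> divides \<open>a\<close>, it also divides the
  error, so divisibility lifts to \<open>R\<close>. If \<open>\<phi>\<close> kills the lead
  coefficient of \<open>f\<close>, the constant \<open>a\<close> takes over. The map is kept
  abstract because both factors of \<open>n\<close> use this lemma.\<close>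

lemma (in cring) lift_strong_reducer:
  fixes leq :: "'x multiset \<Rightarrow> 'x multiset \<Rightarrow> bool"
  assumes mo: "monomial_order leq"
    and \<phi>: "ring_hom_ring R A \<phi>" and surj: "\<phi> ` carrier R = carrier A"
    and a: "a \<in> carrier R" and \<phi>a: "\<phi> a = \<zero>\<^bsub>A\<^esub>"
    and ker: "\<And>x. x \<in> carrier R \<Longrightarrow> \<phi> x = \<zero>\<^bsub>A\<^esub> \<Longrightarrow> a divides x"
    and G: "G \<subseteq> carrier (mpoly R)" and aG: "mconst R a \<in> G"
    and sgb: "strong_groebner_basis leq A ((\<lambda>p. \<phi> \<circ> p) ` J) ((\<lambda>p. \<phi> \<circ> p) ` G)"
    and lcG: "\<forall>g \<in> G - {mconst R a}. g \<noteq> \<zero>\<^bsub>mpoly R\<^esub> \<and> lc leq R g divides a \<and> \<not> a divides lc leq R g"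
    and J: "J \<subseteq> carrier (mpoly R)" and f: "f \<in> J" "f \<noteq> \<zero>\<^bsub>mpoly R\<^esub>"
  shows "\<exists>g\<in>G. g \<noteq> \<zero>\<^bsub>mpoly R\<^esub> \<and> lm leq R g \<subseteq># lm leq R f \<and>
    lc leq R g divides lc leq R f \<and> lc leq R g divides a"
proof -
  interpret \<phi>: ring_hom_ring R A \<phi> by (rule \<phi>)
  have fc: "f \<in> carrier (mpoly R)" using J f by blast
  have lcf: "lc leq R f \<in> carrier R" using fc by (simp add: lc_def mpoly_carrier_coeff)
  have lcf0: "lc leq R f \<noteq> \<zero>" using lm_greatest(1)[OF mo fc f(2)] by (simp add: lc_def)
  \<comment> \<open>Applying \<open>\<phi>\<close> can only shrink the support, so the lead monomial
    stays as long as the lead coefficient survives.\<close>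
  have lm_map: "lm leq A (\<phi> \<circ> p) = lm leq R p"
    if "p \<in> carrier (mpoly R)" "p \<noteq> \<zero>\<^bsub>mpoly R\<^esub>" "\<phi> (lc leq R p) \<noteq> \<zero>\<^bsub>A\<^esub>" for p
  proof (rule lm_eqI[OF mo])
    fix \<beta> assume "(\<phi> \<circ> p) \<beta> \<noteq> \<zero>\<^bsub>A\<^esub>"
    then have "p \<beta> \<noteq> \<zero>" by auto
    then show "leq \<beta> (lm leq R p)" by (rule lm_greatest(2)[OF mo that(1,2)])
  qed (use that in \<open>simp add: lc_def\<close>)
  show ?thesis
  proof (cases "\<phi> (lc leq R f) = \<zero>\<^bsub>A\<^esub>")
    case True
    then have adiv: "a divides lc leq R f" using ker lcf by blast
    \<comment> \<open>The constant \<open>a\<close> has meaningful lead data only if it is nonzero,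
      which holds because it divides a nonzero element.\<close>
    then have a0: "a \<noteq> \<zero>" using lcf0 by (auto simp: factor_def)
    have lma: "lm leq R (mconst R a) = {#}" using mo a0 by (rule lm_mconst)
    then have "lc leq R (mconst R a) = a" by (simp add: lc_def mterm_def)
    moreover have "mconst R a \<noteq> \<zero>\<^bsub>mpoly R\<^esub>"
      using a0 by (auto simp: mpoly_zero mterm_def dest: fun_cong[of _ _ "{#}"])
    ultimately show ?thesis using aG adiv a lma by (intro bexI[of _ "mconst R a"]) auto
  next
    case False
    have "\<phi> \<circ> f \<noteq> \<zero>\<^bsub>mpoly A\<^esub>"
      using False by (auto simp: mpoly_zero lc_def dest: fun_cong[of _ _ "lm leq R f"])
    then obtain g where g: "g \<in> G" "\<phi> \<circ> g \<noteq> \<zero>\<^bsub>mpoly A\<^esub>"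
      and div: "lt leq A (\<phi> \<circ> g) divides\<^bsub>mpoly A\<^esub> lt leq A (\<phi> \<circ> f)"
      using sgb f(1) unfolding strong_groebner_basis_def by blast
    have gc: "g \<in> carrier (mpoly R)" using G g by blast
    have "\<phi> \<circ> mconst R a = \<zero>\<^bsub>mpoly A\<^esub>"
      using \<phi>a by (auto simp: mpoly_zero mterm_def)
    \<comment> \<open>The exceptional constant maps to zero, so \<open>lcG\<close> applies to
      \<open>g\<close>.\<close>
    then have "g \<noteq> mconst R a" using g(2) by blast
    with lcG g(1) have g0: "g \<noteq> \<zero>\<^bsub>mpoly R\<^esub>" and ga: "lc leq R g divides a"
      and nd: "\<not> a divides lc leq R g" by auto
    have lcg: "lc leq R g \<in> carrier R" using gc by (simp add: lc_def mpoly_carrier_coeff)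
    have \<phi>g: "\<phi> (lc leq R g) \<noteq> \<zero>\<^bsub>A\<^esub>" using nd ker lcg by blast
    have ltg: "lt leq A (\<phi> \<circ> g) = mterm A (\<phi> (lc leq R g)) (lm leq R g)"
      using lm_map[OF gc g0 \<phi>g] by (simp add: lt_def lc_def)
    have ltf: "lt leq A (\<phi> \<circ> f) = mterm A (\<phi> (lc leq R f)) (lm leq R f)"
      using lm_map[OF fc f(2) False] by (simp add: lt_def lc_def)
    have sub: "lm leq R g \<subseteq># lm leq R f" and "\<phi> (lc leq R g) divides\<^bsub>A\<^esub> \<phi> (lc leq R f)"
      using \<phi>.S.mterm_dividesD[OF _ False div[unfolded ltg ltf]] lcg by auto
    then obtain y where y: "y \<in> carrier A" "\<phi> (lc leq R f) = \<phi> (lc leq R g) \<otimes>\<^bsub>A\<^esub> y"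
      unfolding factor_def by blast
    from y(1) have "y \<in> \<phi> ` carrier R" by (simp only: surj)
    then obtain t where "t \<in> carrier R" "y = \<phi> t" by (rule imageE)
    with y(2) have t: "t \<in> carrier R" "\<phi> (lc leq R f) = \<phi> (lc leq R g) \<otimes>\<^bsub>A\<^esub> \<phi> t"
      by simp_all
    \<comment> \<open>The lifted quotient \<open>t\<close> is correct up to a kernel element
      \<open>a \<otimes> s\<close>. Writing \<open>a\<close> as
      \<open>lc leq R g \<otimes> r\<close>, the corrected quotient is
      \<open>t \<oplus> r \<otimes> s\<close>.\<close>
    have "\<phi> (lc leq R f \<ominus> lc leq R g \<otimes> t) = \<zero>\<^bsub>A\<^esub>"
      using t lcf lcg by (simp add: a_minus_def \<phi>.S.r_neg)
    then obtain s where s: "s \<in> carrier R" "lc leq R f \<ominus> lc leq R g \<otimes> t = a \<otimes> s"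
      using ker[of "lc leq R f \<ominus> lc leq R g \<otimes> t"] lcf lcg t by (auto simp: factor_def)
    obtain r where r: "r \<in> carrier R" "a = lc leq R g \<otimes> r" using ga by (auto simp: factor_def)
    have "lc leq R f = lc leq R g \<otimes> t \<oplus> (lc leq R f \<ominus> lc leq R g \<otimes> t)"
      using lcf lcg t(1) by algebra
    also have "\<dots> = lc leq R g \<otimes> (t \<oplus> r \<otimes> s)"
      unfolding s(2) using lcg t(1) r s(1) by (simp add: r_distr m_assoc)
    finally have "lc leq R g divides lc leq R f"
      using t(1) r(1) s(1) by (auto simp: factor_def)
    with g(1) g0 sub ga show ?thesis by blast
  qed
qed

section \<open>Gluing two polynomials\<close>

text \<open>Expand \<open>x\<close> as
  \<open>u \<otimes> a \<otimes> x \<oplus> v \<otimes> b \<otimes> x\<close>. In the first summand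
  \<open>a\<close> supplies \<open>c\<close> and \<open>x\<close> supplies \<open>d\<close>; in the
  second \<open>b\<close> supplies \<open>d\<close> and \<open>x\<close> supplies \<open>c\<close>.
  No cancellation occurs, so zero divisors are allowed.\<close>

lemma (in cring) coprime_product_divides:
  assumes carr: "a \<in> carrier R" "b \<in> carrier R" "u \<in> carrier R" "v \<in> carrier R"
      "c \<in> carrier R" "d \<in> carrier R"
    and one: "u \<otimes> a \<oplus> v \<otimes> b = \<one>"
    and "c divides a" "d divides b" "c divides x" "d divides x"
  shows "c \<otimes> d divides x"
proof -
  obtain p q s t where pq: "p \<in> carrier R" "q \<in> carrier R" "s \<in> carrier R" "t \<in> carrier R"
    and a: "a = c \<otimes> p" and b: "b = d \<otimes> q" and xc: "x = c \<otimes> s" and xd: "x = d \<otimes> t"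
    using assms(8-) by (auto simp: factor_def)
  have "x = u \<otimes> a \<otimes> x \<oplus> v \<otimes> b \<otimes> x"
    using carr one pq xc by (metis l_distr l_one m_closed)
  also have "\<dots> = u \<otimes> (c \<otimes> p) \<otimes> (d \<otimes> t) \<oplus> v \<otimes> (d \<otimes> q) \<otimes> (c \<otimes> s)"
    using a b xc xd by simp
  also have "\<dots> = (c \<otimes> d) \<otimes> (u \<otimes> p \<otimes> t \<oplus> v \<otimes> q \<otimes> s)"
    using carr(3-) pq by algebra
  finally show ?thesis using carr(3-) pq by (auto simp: factor_def)
qed

text \<open>Both summands are shifted to the monomial \<open>m\<close>, where their coefficients are
  \<open>e\<close> and \<open>e'\<close> times the same product of lead coefficients. Either one may
  vanish, but their sum is that product, and \<open>nz\<close> keeps it from being zero.\<close>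

lemma (in cring) lead_of_glued:
  fixes leq :: "'x multiset \<Rightarrow> 'x multiset \<Rightarrow> bool" and g h :: "'x multiset \<Rightarrow> 'a"
  defines "m \<equiv> lm leq R g \<union># lm leq R h"
  assumes mo: "monomial_order leq"
    and g: "g \<in> carrier (mpoly R)" "g \<noteq> \<zero>\<^bsub>mpoly R\<^esub>" and h: "h \<in> carrier (mpoly R)" "h \<noteq> \<zero>\<^bsub>mpoly R\<^esub>"
    and e: "e \<in> carrier R" "e' \<in> carrier R" "e \<oplus> e' = \<one>"
    and nz: "lc leq R g \<otimes> lc leq R h \<noteq> \<zero>"
    and f: "f = mterm R (e \<otimes> lc leq R g) (m - lm leq R h) \<otimes>\<^bsub>mpoly R\<^esub> h
       \<oplus>\<^bsub>mpoly R\<^esub> mterm R (e' \<otimes> lc leq R h) (m - lm leq R g) \<otimes>\<^bsub>mpoly R\<^esub> g"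
  shows "f \<noteq> \<zero>\<^bsub>mpoly R\<^esub>" and "lm leq R f = m" and "lc leq R f = lc leq R g \<otimes> lc leq R h"
proof -
  let ?c = "lc leq R g" and ?d = "lc leq R h"
  have carr: "?c \<in> carrier R" "?d \<in> carrier R"
    using g h by (auto simp: lc_def mpoly_carrier_coeff)
  have coeff: "f \<alpha> = (if m - lm leq R h \<subseteq># \<alpha> then e \<otimes> ?c \<otimes> h (\<alpha> - (m - lm leq R h)) else \<zero>)
      \<oplus> (if m - lm leq R g \<subseteq># \<alpha> then e' \<otimes> ?d \<otimes> g (\<alpha> - (m - lm leq R g)) else \<zero>)" for \<alpha>
    unfolding f mpoly_add_coeff using carr e g h
    by (simp add: mterm_mult_coeff mpoly_carrier_coeff)
  have sub: "lm leq R h \<subseteq># m" "lm leq R g \<subseteq># m" by (auto simp: m_def)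
  then have diff: "m - (m - lm leq R h) = lm leq R h" "m - (m - lm leq R g) = lm leq R g"
    by (simp_all add: multiset_eq_iff subseteq_mset_def)
  have "f m = e \<otimes> ?c \<otimes> ?d \<oplus> e' \<otimes> ?d \<otimes> ?c"
    unfolding coeff diff by (simp add: lc_def)
  also have "\<dots> = (e \<oplus> e') \<otimes> (?c \<otimes> ?d)"
    using carr e(1,2) by algebra
  finally have fm: "f m = ?c \<otimes> ?d" using e carr by simp
  have le: "leq \<beta> m" if "f \<beta> \<noteq> \<zero>" for \<beta>
  proof -
    \<comment> \<open>By translation invariance, multiplying \<open>p\<close> by the monomial
      \<open>m - lm leq R p\<close> moves its support below \<open>m\<close>.\<close>
    have shift: "leq \<beta> m"
      if p: "p \<in> carrier (mpoly R)" "p \<noteq> \<zero>\<^bsub>mpoly R\<^esub>" and pm: "lm leq R p \<subseteq># m"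
        and sub: "m - lm leq R p \<subseteq># \<beta>" and nz: "p (\<beta> - (m - lm leq R p)) \<noteq> \<zero>" for p
    proof -
      have "leq (\<beta> - (m - lm leq R p) + (m - lm leq R p)) (lm leq R p + (m - lm leq R p))"
        by (intro monomial_order_add[OF mo] lm_greatest(2)[OF mo p] nz)
      then show ?thesis using sub pm by simp
    qed
    from that have "(m - lm leq R h \<subseteq># \<beta> \<and> h (\<beta> - (m - lm leq R h)) \<noteq> \<zero>) \<or>
        (m - lm leq R g \<subseteq># \<beta> \<and> g (\<beta> - (m - lm leq R g)) \<noteq> \<zero>)"
      unfolding coeff using carr e by (auto split: if_splits)
    then show ?thesis using shift g h sub by blast
  qed
  show lmf: "lm leq R f = m"
    using mo by (rule lm_eqI) (use fm nz le in auto)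
  show "f \<noteq> \<zero>\<^bsub>mpoly R\<^esub>" using fm nz by (auto simp: mpoly_zero)
  show "lc leq R f = ?c \<otimes> ?d" using fm lmf by (simp add: lc_def)
qed

text \<open>The polynomial \<open>g\<close> itself need not lie in \<open>J\<close>. It has the same
  image as some \<open>i\<close> in \<open>J\<close>, and the factor \<open>e\<close> erases the
  difference, so \<open>g\<close> can be replaced by \<open>i\<close> in the product.\<close>

lemma (in cring) annihilated_mult_mem:
  assumes J: "ideal J (mpoly R)"
    and \<phi>: "ring_hom_ring R A \<phi>"
    and ker: "\<And>x. x \<in> carrier R \<Longrightarrow> \<phi> x = \<zero>\<^bsub>A\<^esub> \<Longrightarrow> a divides x"
    and a: "a \<in> carrier R" and e: "e \<in> carrier R" "e \<otimes> a = \<zero>" and d: "d \<in> carrier R"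
    and g: "g \<in> carrier (mpoly R)" "\<phi> \<circ> g \<in> (\<lambda>p. \<phi> \<circ> p) ` J"
  shows "mterm R (e \<otimes> d) \<gamma> \<otimes>\<^bsub>mpoly R\<^esub> g \<in> J"
proof -
  obtain i where i: "i \<in> J" "\<phi> \<circ> g = \<phi> \<circ> i" using g(2) by blast
  have ic: "i \<in> carrier (mpoly R)"
    using i(1) ideal.Icarr[OF J] by blast
  have eq: "e \<otimes> d \<otimes> g \<alpha> = e \<otimes> d \<otimes> i \<alpha>" for \<alpha>
  proof -
    have ga: "g \<alpha> \<in> carrier R" "i \<alpha> \<in> carrier R" using g ic by (auto intro: mpoly_carrier_coeff)
    have "e \<otimes> g \<alpha> = e \<otimes> i \<alpha>"
      using ker \<phi> a e ga fun_cong[OF i(2), of \<alpha>] by (intro factor_annihilates[of \<phi> A a e]) auto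
    then show ?thesis using e d ga by (metis m_assoc m_comm)
  qed
  have "mterm R (e \<otimes> d) \<gamma> \<otimes>\<^bsub>mpoly R\<^esub> g = mterm R (e \<otimes> d) \<gamma> \<otimes>\<^bsub>mpoly R\<^esub> i"
    using e d g ic eq by (intro ext) (simp add: mterm_mult_coeff mpoly_carrier_coeff)
  also have "\<dots> \<in> J"
    using e d i(1) by (intro ideal.I_l_closed[OF J] mterm_closed) auto
  finally show ?thesis .
qed

section \<open>The canonical projection between residue rings\<close>

text \<open>These are the properties of the projection that the lifting lemmas require: a surjective
  homomorphism that kills the class of \<open>a\<close> and whose kernel consists of multiples of
  that class.\<close>

lemma (in cring) residue_projection:
  assumes n: "n \<in> carrier R" and a: "a \<in> carrier R" and b: "b \<in> carrier R" and nab: "n = a \<otimes> b"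
  defines "\<phi> \<equiv> \<lambda>X. PIdl a <+>\<^bsub>R\<^esub> X"
  shows "ring_hom_ring (residue_ring R n) (residue_ring R a) \<phi>"
    and "\<phi> ` carrier (residue_ring R n) = carrier (residue_ring R a)"
    and "\<phi> (residue R n a) = \<zero>\<^bsub>residue_ring R a\<^esub>"
    and "\<And>x. x \<in> carrier (residue_ring R n) \<Longrightarrow> \<phi> x = \<zero>\<^bsub>residue_ring R a\<^esub>
      \<Longrightarrow> residue R n a divides\<^bsub>residue_ring R n\<^esub> x"
proof -
  have mem: "y \<in> PIdl m \<longleftrightarrow> (\<exists>s\<in>carrier R. y = s \<otimes> m)" for y m
    unfolding cgenideal_def by blast
  have zero_eq: "\<zero>\<^bsub>residue_ring R m\<^esub> = PIdl m" for m
    by (simp add: FactRing_def)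
  interpret In: ideal "PIdl n" R using n by (rule cgenideal_ideal)
  interpret Ia: ideal "PIdl a" R using a by (rule cgenideal_ideal)
  interpret hn: ring_hom_ring R "residue_ring R n" "residue R n" by (rule In.rcos_ring_hom_ring)
  interpret ha: ring_hom_ring R "residue_ring R a" "residue R a" by (rule Ia.rcos_ring_hom_ring)
  have sub: "PIdl n \<subseteq> PIdl a"
  proof
    fix x assume "x \<in> PIdl n"
    then obtain r where r: "r \<in> carrier R" "x = r \<otimes> n" unfolding mem by blast
    then have "x = (r \<otimes> b) \<otimes> a" using a b nab by (simp add: m_ac)
    then show "x \<in> PIdl a" using r b unfolding mem by blast
  qed
  \<comment> \<open>The ideal of \<open>a\<close> absorbs the smaller ideal of \<open>n\<close>.
    From here on everything is checked on representatives.\<close>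
  have \<phi>: "\<phi> (residue R n r) = residue R a r" if r: "r \<in> carrier R" for r
  proof -
    have "PIdl a <+>\<^bsub>R\<^esub> PIdl n = PIdl a"
    proof
      show "PIdl a <+>\<^bsub>R\<^esub> PIdl n \<subseteq> PIdl a" using sub by (auto simp: set_add_def')
      show "PIdl a \<subseteq> PIdl a <+>\<^bsub>R\<^esub> PIdl n"
      proof
        fix x assume x: "x \<in> PIdl a"
        then have "x = x \<oplus> \<zero>" by simp
        with x show "x \<in> PIdl a <+>\<^bsub>R\<^esub> PIdl n"
          unfolding set_add_def' using In.zero_closed by blast
      qed
    qed
    moreover have "PIdl a <+>\<^bsub>R\<^esub> (PIdl n +> r) = (PIdl a <+>\<^bsub>R\<^esub> PIdl n) +> r"
    proof -
      have "PIdl a \<subseteq> carrier R" "PIdl n \<subseteq> carrier R" using Ia.a_subset In.a_subset by auto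
      then show ?thesis using r by (simp add: a_setmult_rcos_assoc)
    qed
    ultimately show ?thesis by (simp add: \<phi>_def)
  qed
  have repr: "\<exists>r\<in>carrier R. x = residue R m r" if "x \<in> carrier (residue_ring R m)" for m x
    using that by (auto simp: FactRing_def A_RCOSETS_def')
  show "ring_hom_ring (residue_ring R n) (residue_ring R a) \<phi>"
  proof (rule ring_hom_ringI2)
    show "\<phi> \<in> ring_hom (residue_ring R n) (residue_ring R a)"
    proof (rule ring_hom_memI)
      fix x assume "x \<in> carrier (residue_ring R n)"
      then show "\<phi> x \<in> carrier (residue_ring R a)" using repr[of x n] \<phi> by auto
    next
      fix x y assume "x \<in> carrier (residue_ring R n)" "y \<in> carrier (residue_ring R n)"
      then obtain r s where rs: "r \<in> carrier R" "s \<in> carrier R"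
        and [simp]: "x = residue R n r" "y = residue R n s" using repr by meson
      show "\<phi> (x \<otimes>\<^bsub>residue_ring R n\<^esub> y) = \<phi> x \<otimes>\<^bsub>residue_ring R a\<^esub> \<phi> y"
        using rs by (simp add: \<phi> flip: hn.hom_mult ha.hom_mult)
      show "\<phi> (x \<oplus>\<^bsub>residue_ring R n\<^esub> y) = \<phi> x \<oplus>\<^bsub>residue_ring R a\<^esub> \<phi> y"
        using rs by (simp add: \<phi> flip: hn.hom_add ha.hom_add)
    next
      show "\<phi> \<one>\<^bsub>residue_ring R n\<^esub> = \<one>\<^bsub>residue_ring R a\<^esub>"
        by (simp add: \<phi> flip: hn.hom_one ha.hom_one)
    qed
  qed (rule hn.S.ring_axioms ha.S.ring_axioms)+
  show "\<phi> ` carrier (residue_ring R n) = carrier (residue_ring R a)"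
  proof
    show "\<phi> ` carrier (residue_ring R n) \<subseteq> carrier (residue_ring R a)"
      using repr[of _ n] \<phi> by force
    show "carrier (residue_ring R a) \<subseteq> \<phi> ` carrier (residue_ring R n)"
      using repr[of _ a] \<phi> by (metis hn.hom_closed image_eqI subsetI)
  qed
  \<comment> \<open>The zero of the quotient is the ideal itself, as a coset.\<close>
  have zero: "residue R a r = \<zero>\<^bsub>residue_ring R a\<^esub> \<longleftrightarrow> r \<in> PIdl a" if "r \<in> carrier R" for r
  proof
    assume "r \<in> PIdl a"
    then show "residue R a r = \<zero>\<^bsub>residue_ring R a\<^esub>" by (simp only: zero_eq Ia.a_rcos_const)
  next
    assume "residue R a r = \<zero>\<^bsub>residue_ring R a\<^esub>"
    with Ia.a_rcos_self[OF that] show "r \<in> PIdl a" by (simp only: zero_eq)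
  qed
  show "\<phi> (residue R n a) = \<zero>\<^bsub>residue_ring R a\<^esub>"
    using a by (simp add: \<phi> zero cgenideal_self)
  fix x assume x: "x \<in> carrier (residue_ring R n)" "\<phi> x = \<zero>\<^bsub>residue_ring R a\<^esub>"
  then obtain r where r: "r \<in> carrier R" "x = residue R n r" using repr by blast
  with x(2) have "r \<in> PIdl a" by (simp add: \<phi> zero)
  then obtain s where "s \<in> carrier R" "r = a \<otimes> s" using a m_comm unfolding mem by blast
  then have "x = residue R n a \<otimes>\<^bsub>residue_ring R n\<^esub> residue R n s" using r a by simp
  then show "residue R n a divides\<^bsub>residue_ring R n\<^esub> x"
    using \<open>s \<in> carrier R\<close> by (auto simp: factor_def)
qed

section \<open>The glued polynomials form a strong Groebner basis\<close>

theorem corollary13: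
  fixes R :: "('r, 'm) ring_scheme" (structure)
    and leq :: "'x::finite multiset \<Rightarrow> 'x multiset \<Rightarrow> bool"
    and n a b u v :: 'r
    and I :: "('x multiset \<Rightarrow> 'r set) set"
    and K :: "'k set" and L :: "'l set"
    and ga :: "'k \<Rightarrow> 'x multiset \<Rightarrow> 'r set"
    and gb :: "'l \<Rightarrow> 'x multiset \<Rightarrow> 'r set"
  assumes "principal_domain R"
    and "global_monomial_order leq"
    and "n \<in> carrier R" and "n \<noteq> \<zero>"
    and "ideal I (mpoly (residue_ring R n))"
    and "a \<in> carrier R" and "b \<in> carrier R" and "n = a \<otimes> b"
    and "\<one> gcdof a b"
    and "u \<in> carrier R" and "v \<in> carrier R" and "\<one> = u \<otimes> a \<oplus> v \<otimes> b"
    and "finite K" and "finite L"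
    and "ga ` K \<subseteq> carrier (mpoly (residue_ring R n))"
    and "strong_groebner_basis leq (residue_ring R a) (proj_poly R a ` I) (proj_poly R a ` ga ` K)"
    and "mconst (residue_ring R n) (residue R n a) \<in> ga ` K"
    and "\<forall>g \<in> ga ` K - {mconst (residue_ring R n) (residue R n a)}.
           g \<noteq> \<zero>\<^bsub>mpoly (residue_ring R n)\<^esub> \<and>
           lc leq (residue_ring R n) g divides\<^bsub>residue_ring R n\<^esub> residue R n a \<and>
           \<not> residue R n a divides\<^bsub>residue_ring R n\<^esub> lc leq (residue_ring R n) g"
    and "gb ` L \<subseteq> carrier (mpoly (residue_ring R n))"
    and "strong_groebner_basis leq (residue_ring R b) (proj_poly R b ` I) (proj_poly R b ` gb ` L)"
    and "mconst (residue_ring R n) (residue R n b) \<in> gb ` L"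
    and "\<forall>g \<in> gb ` L - {mconst (residue_ring R n) (residue R n b)}.
           g \<noteq> \<zero>\<^bsub>mpoly (residue_ring R n)\<^esub> \<and>
           lc leq (residue_ring R n) g divides\<^bsub>residue_ring R n\<^esub> residue R n b \<and>
           \<not> residue R n b divides\<^bsub>residue_ring R n\<^esub> lc leq (residue_ring R n) g"
  shows "strong_groebner_basis leq (residue_ring R n) I
           {glue_poly leq R n u a v b (ga k) (gb l) | k l. k \<in> K \<and> l \<in> L}"
proof -
  note gmo = assms(2) and n = assms(3) and I = assms(5) and a = assms(6) and b = assms(7)
    and u = assms(10) and v = assms(11) and ga = assms(15) and gb = assms(19)
  interpret principal_domain R by (rule assms(1))
  let ?Q = "residue_ring R n" and ?A = "residue_ring R a" and ?B = "residue_ring R b"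
  let ?r = "residue R n"
  let ?\<phi> = "\<lambda>X. PIdl a <+>\<^bsub>R\<^esub> X" and ?\<psi> = "\<lambda>X. PIdl b <+>\<^bsub>R\<^esub> X"
  have mo: "monomial_order leq" using gmo by (simp add: global_monomial_order_def)
  have zero_Q: "\<zero>\<^bsub>?Q\<^esub> = PIdl n" by (simp add: FactRing_def)
  interpret In: ideal "PIdl n" R using n by (rule cgenideal_ideal)
  interpret Q: cring ?Q by (rule In.quotient_is_cring) (rule is_cring)
  interpret r: ring_hom_ring R ?Q ?r by (rule In.rcos_ring_hom_ring)
  interpret I: ideal I "mpoly ?Q" by (rule I)
  have proj_a: "proj_poly R a = (\<lambda>p. ?\<phi> \<circ> p)" and proj_b: "proj_poly R b = (\<lambda>p. ?\<psi> \<circ> p)"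
    by (auto simp: proj_poly_def comp_def)
  note \<phi> = residue_projection[OF n a b assms(8)]
  \<comment> \<open>Commuting the factors lets the same lemma serve for \<open>b\<close>.\<close>
  have nba: "n = b \<otimes> a" using assms(8) a b by (simp add: m_comm)
  note \<psi> = residue_projection[OF n b a nba]
  have ra: "?r a \<in> carrier ?Q" and rb: "?r b \<in> carrier ?Q"
    and ru: "?r u \<in> carrier ?Q" and rv: "?r v \<in> carrier ?Q"
    and ua: "?r (u \<otimes> a) \<in> carrier ?Q" and vb: "?r (v \<otimes> b) \<in> carrier ?Q" using a b u v by auto
  have "?r n = \<zero>\<^bsub>?Q\<^esub>"
    unfolding zero_Q by (rule In.a_rcos_const) (rule cgenideal_self[OF n])
  then have rba: "?r b \<otimes>\<^bsub>?Q\<^esub> ?r a = \<zero>\<^bsub>?Q\<^esub>" and rab: "?r a \<otimes>\<^bsub>?Q\<^esub> ?r b = \<zero>\<^bsub>?Q\<^esub>"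
    using r.hom_mult[OF b a, folded nba] r.hom_mult[OF a b, folded assms(8)] by simp_all
  have one: "?r (u \<otimes> a) \<oplus>\<^bsub>?Q\<^esub> ?r (v \<otimes> b) = \<one>\<^bsub>?Q\<^esub>"
    using a b u v assms(12) by (simp flip: r.hom_add r.hom_mult r.hom_one)
  \<comment> \<open>In the residue ring \<open>a \<otimes> b\<close> becomes zero, so the two
    idempotents annihilate the opposite factors.\<close>
  have uab: "?r (u \<otimes> a) \<otimes>\<^bsub>?Q\<^esub> ?r b = \<zero>\<^bsub>?Q\<^esub>" and vba: "?r (v \<otimes> b) \<otimes>\<^bsub>?Q\<^esub> ?r a = \<zero>\<^bsub>?Q\<^esub>"
    using a b u v ra rb ru rv rab rba by (simp_all add: Q.m_assoc)
  have lc_closed: "lc leq ?Q p \<in> carrier ?Q" if "p \<in> carrier (mpoly ?Q)" for p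
    using that by (simp add: lc_def mpoly_carrier_coeff)
  let ?f = "\<lambda>g h. glue_poly leq R n u a v b g h"
  show ?thesis
  proof (rule strong_groebner_basisI)
    show "finite {?f (ga k) (gb l) | k l. k \<in> K \<and> l \<in> L}"
      by (rule finite_image_set2) (simp_all only: Collect_mem_eq assms(13,14))
    show "{?f (ga k) (gb l) | k l. k \<in> K \<and> l \<in> L} \<subseteq> I"
    proof clarify
      fix k l assume k: "k \<in> K" and l: "l \<in> L"
      let ?g = "ga k" and ?h = "gb l"
      have g: "?g \<in> carrier (mpoly ?Q)" and h: "?h \<in> carrier (mpoly ?Q)" using k l ga gb by auto
      have \<phi>g: "?\<phi> \<circ> ?g \<in> (\<lambda>p. ?\<phi> \<circ> p) ` I"
        using assms(16) k unfolding strong_groebner_basis_def groebner_basis_def proj_a by blast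
      have \<psi>h: "?\<psi> \<circ> ?h \<in> (\<lambda>p. ?\<psi> \<circ> p) ` I"
        using assms(20) l unfolding strong_groebner_basis_def groebner_basis_def proj_b by blast
      have "mterm ?Q (?r (v \<otimes> b) \<otimes>\<^bsub>?Q\<^esub> lc leq ?Q ?h) \<gamma> \<otimes>\<^bsub>mpoly ?Q\<^esub> ?g \<in> I" for \<gamma>
        by (rule Q.annihilated_mult_mem[OF I \<phi>(1,4) ra vb vba lc_closed[OF h] g \<phi>g])
      moreover have "mterm ?Q (?r (u \<otimes> a) \<otimes>\<^bsub>?Q\<^esub> lc leq ?Q ?g) \<gamma> \<otimes>\<^bsub>mpoly ?Q\<^esub> ?h \<in> I" for \<gamma>
        by (rule Q.annihilated_mult_mem[OF I \<psi>(1,4) rb ua uab lc_closed[OF g] h \<psi>h])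
      \<comment> \<open>If \<open>?g\<close> or \<open>?h\<close> is zero, the glued polynomial is
        zero by convention and lies in \<open>I\<close> as well.\<close>
      ultimately show "?f ?g ?h \<in> I"
        by (simp add: glue_poly_def Let_def I.a_closed)
    qed
  next
    fix f assume f: "f \<in> I" "f \<noteq> \<zero>\<^bsub>mpoly ?Q\<^esub>"
    let ?x = "lc leq ?Q f"
    have fc: "f \<in> carrier (mpoly ?Q)" using f(1) by (rule I.Icarr)
    obtain g where g: "g \<in> ga ` K" "g \<noteq> \<zero>\<^bsub>mpoly ?Q\<^esub>" "lm leq ?Q g \<subseteq># lm leq ?Q f"
      "lc leq ?Q g divides\<^bsub>?Q\<^esub> ?x" "lc leq ?Q g divides\<^bsub>?Q\<^esub> ?r a"
      using Q.lift_strong_reducer[OF mo \<phi>(1,2) ra \<phi>(3,4) ga assms(17)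
          assms(16)[unfolded proj_a] assms(18) I.a_subset f] by auto
    obtain h where h: "h \<in> gb ` L" "h \<noteq> \<zero>\<^bsub>mpoly ?Q\<^esub>" "lm leq ?Q h \<subseteq># lm leq ?Q f"
      "lc leq ?Q h divides\<^bsub>?Q\<^esub> ?x" "lc leq ?Q h divides\<^bsub>?Q\<^esub> ?r b"
      using Q.lift_strong_reducer[OF mo \<psi>(1,2) rb \<psi>(3,4) gb assms(21)
          assms(20)[unfolded proj_b] assms(22) I.a_subset f] by auto
    have gc: "g \<in> carrier (mpoly ?Q)" and hc: "h \<in> carrier (mpoly ?Q)" using g h ga gb by auto
    let ?cd = "lc leq ?Q g \<otimes>\<^bsub>?Q\<^esub> lc leq ?Q h"
    have cd: "?cd divides\<^bsub>?Q\<^esub> ?x"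
      using one a b u v
      by (intro Q.coprime_product_divides[OF ra rb ru rv lc_closed[OF gc] lc_closed[OF hc] _
            g(5) h(5) g(4) h(4)]) simp
    have "?x \<noteq> \<zero>\<^bsub>?Q\<^esub>" using lm_greatest(1)[OF mo fc f(2)] by (simp add: lc_def)
    \<comment> \<open>A product of nonzero lead coefficients may vanish here; this one does not, as
      it divides the nonzero \<open>?x\<close>.\<close>
    with cd have cd0: "?cd \<noteq> \<zero>\<^bsub>?Q\<^esub>" by (auto simp: factor_def)
    have "?f g h = mterm ?Q (?r (u \<otimes> a) \<otimes>\<^bsub>?Q\<^esub> lc leq ?Q g)
          (lm leq ?Q g \<union># lm leq ?Q h - lm leq ?Q h) \<otimes>\<^bsub>mpoly ?Q\<^esub> h
       \<oplus>\<^bsub>mpoly ?Q\<^esub> mterm ?Q (?r (v \<otimes> b) \<otimes>\<^bsub>?Q\<^esub> lc leq ?Q h)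
          (lm leq ?Q g \<union># lm leq ?Q h - lm leq ?Q g) \<otimes>\<^bsub>mpoly ?Q\<^esub> g"
      using g(2) h(2) by (simp add: glue_poly_def Let_def)
    note lead = Q.lead_of_glued[OF mo gc g(2) hc h(2) ua vb one cd0 this]
    \<comment> \<open>Both lead monomials divide that of \<open>f\<close>, hence so does their least
      common multiple; \<open>cd\<close> handles the coefficients.\<close>
    have "lt leq ?Q (?f g h) divides\<^bsub>mpoly ?Q\<^esub> lt leq ?Q f"
      unfolding lt_def lead(2,3) using g(3) h(3) cd lc_closed[OF gc] lc_closed[OF hc]
      by (intro Q.mterm_dividesI) (auto simp: subset_mset.sup_least)
    then show "\<exists>p\<in>{?f (ga k) (gb l) | k l. k \<in> K \<and> l \<in> L}.
        p \<noteq> \<zero>\<^bsub>mpoly ?Q\<^esub> \<and> lt leq ?Q p divides\<^bsub>mpoly ?Q\<^esub> lt leq ?Q f"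
      using g(1) h(1) lead(1) by blast
  qed
qed

end
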